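(* Let $M=\|m_i^j\|_{1\le i,j\le N}$ be the generating matrix of the enveloping algebra $U(gl(N))$, where $m_i^j$, $1\le i,j\le N$, is the standard basis of $gl(N)$. Then the polynomial $$\mathcal Q(t)=\mathrm{Tr}_{(1\dots N)}\Big(\mathcal P_-^{(N)}(tI-M_1)((t-1)I-M_2)\cdots((t-N+1)I-M_N)\Big),$$ where $\mathcal P_-^{(N)}$ is the usual skew-symmetrizer in $V^{\otimes N}$ ($\dim V=N$), is characteristic for this matrix, that is, $\mathcal Q(M)=0$.
   Context: $M_k$ denotes the matrix $M$ placed in the $k$-th tensor factor of $\mathrm{End}(V)^{\otimes N}$, where $\dim V=N$ over $\mathbb K=\mathbb C$ or $\mathbb R$; $\mathrm{Tr}_{(1\dots N)}$ is the ordinary trace over all $N$ factors. Lower index = row, upper index = column. The generators satisfy $PM_1PM_1-M_1PM_1P=PM_1-M_1P$ ($P$ the flip on $V^{\otimes 2}$), i.e. $[m_i^j,m_k^l]=\delta_k^jm_i^l-\delta_i^lm_k^j$. The skew-symmetrizer is $\mathcal P_-^{(N)}=\frac1{N!}\sum_{\sigma\in S_N}\mathrm{sgn}(\sigma)\,\sigma$ acting by permuting the factors of $V^{\otimes N}$. The coefficients of $\mathcal Q(t)$ are (central) elements of $U(gl(N))$, and $\mathcal Q(M)$ is obtained by substituting for $t$ the matrix $M$ with its usual matrix powers. *)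

theory Defs
  imports "HOL-Analysis.Analysis" "HOL-Library.Poly_Mapping" "HOL-Combinatorics.Permutations"
begin

section \<open>The enveloping algebra of gl(N)\<close>

text \<open>
  The tensor algebra on a vector space with basis \<open>'a\<close> is the free associative algebra on \<open>'a\<close>,
  i.e. the monoid algebra \<open>'a free_monoid \<Rightarrow>\<^sub>0 'k\<close> of the monoid of words.
  A wrapper around lists is used because \<open>list\<close> itself is left without a \<open>monoid_add\<close> instance.
\<close>

datatype 'a free_monoid = Word "'a list"

fun letters :: "'a free_monoid \<Rightarrow> 'a list" where
  "letters (Word xs) = xs"

instantiation free_monoid :: (type) monoid_add
begin

definition zero_free_monoid :: "'a free_monoid" where
  "0 = Word []"

definition plus_free_monoid :: "'a free_monoid \<Rightarrow> 'a free_monoid \<Rightarrow> 'a free_monoid" where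
  "u + v = Word (letters u @ letters v)"

instance
proof
  fix a b c :: "'a free_monoid"
  show "a + b + c = a + (b + c)" by (simp add: plus_free_monoid_def)
  show "0 + a = a" by (cases a) (simp add: plus_free_monoid_def zero_free_monoid_def)
  show "a + 0 = a" by (cases a) (simp add: plus_free_monoid_def zero_free_monoid_def)
qed

end

text \<open>The letter \<open>(i, j)\<close> stands for $m_i^j$: lower index first.\<close>

definition free_gen :: "'n \<Rightarrow> 'n \<Rightarrow> ('n \<times> 'n) free_monoid \<Rightarrow>\<^sub>0 'k::comm_ring_1" where
  "free_gen i j = Poly_Mapping.single (Word [(i, j)]) 1"

definition gl_relator ::
  "'n \<Rightarrow> 'n \<Rightarrow> 'n \<Rightarrow> 'n \<Rightarrow> ('n \<times> 'n) free_monoid \<Rightarrow>\<^sub>0 'k::comm_ring_1" where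
  "gl_relator i j k l =
     (free_gen i j * free_gen k l - free_gen k l * free_gen i j)
     - ((if k = j then free_gen i l else 0) - (if i = l then free_gen k j else 0))"

text \<open>The two-sided ideal generated by the relators.\<close>

inductive_set gl_ideal :: "(('n \<times> 'n) free_monoid \<Rightarrow>\<^sub>0 'k::comm_ring_1) set" where
  zero: "0 \<in> gl_ideal"
| add: "p \<in> gl_ideal \<Longrightarrow> a * gl_relator i j k l * b + p \<in> gl_ideal"

lemma gl_ideal_relator: "gl_relator i j k l \<in> gl_ideal"
  using gl_ideal.add[OF gl_ideal.zero, of 1 i j k l 1] by simp

lemma gl_ideal_plus: "p \<in> gl_ideal \<Longrightarrow> q \<in> gl_ideal \<Longrightarrow> p + q \<in> gl_ideal"
  by (induction rule: gl_ideal.induct) (auto simp: add.assoc intro: gl_ideal.add)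

lemma gl_ideal_mult_left: "p \<in> gl_ideal \<Longrightarrow> c * p \<in> gl_ideal"
proof (induction rule: gl_ideal.induct)
  case (add p a i j k l b)
  then show ?case
    using gl_ideal.add[of "c * p" "c * a" i j k l b] by (simp add: algebra_simps)
qed (simp add: gl_ideal.zero)

lemma gl_ideal_mult_right: "p \<in> gl_ideal \<Longrightarrow> p * c \<in> gl_ideal"
proof (induction rule: gl_ideal.induct)
  case (add p a i j k l b)
  then show ?case
    using gl_ideal.add[of "p * c" a i j k l "b * c"] by (simp add: algebra_simps)
qed (simp add: gl_ideal.zero)

lemma gl_ideal_uminus: "p \<in> gl_ideal \<Longrightarrow> - p \<in> gl_ideal"
  using gl_ideal_mult_left[of p "-1"] by simp

lemma gl_ideal_minus: "p \<in> gl_ideal \<Longrightarrow> q \<in> gl_ideal \<Longrightarrow> p - q \<in> gl_ideal"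
  using gl_ideal_plus[of p "- q"] gl_ideal_uminus[of q] by simp

lemma plus_free_monoid_eq_0_iff: "u + v = 0 \<longleftrightarrow> u = 0 \<and> v = (0 :: 'a free_monoid)"
  by (cases u; cases v) (simp add: plus_free_monoid_def zero_free_monoid_def)

lemma lookup_mult_0_free_monoid:
  fixes p q :: "'a free_monoid \<Rightarrow>\<^sub>0 'k::comm_ring_1"
  shows "Poly_Mapping.lookup (p * q) 0 = Poly_Mapping.lookup p 0 * Poly_Mapping.lookup q 0"
proof -
  have "Poly_Mapping.lookup (p * q) 0 =
      (\<Sum>l. Poly_Mapping.lookup p l * (\<Sum>r. Poly_Mapping.lookup q r when 0 = l + r))"
    by (simp add: lookup_mult)
  also have "\<dots> = (\<Sum>l. (Poly_Mapping.lookup p l * Poly_Mapping.lookup q 0) when l = 0)"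
  proof (rule Sum_any.cong)
    fix l :: "'a free_monoid"
    have "(\<Sum>r. Poly_Mapping.lookup q r when 0 = l + r)
        = (\<Sum>r. (Poly_Mapping.lookup q r when l = 0) when r = 0)"
      by (rule Sum_any.cong) (auto simp: when_def plus_free_monoid_eq_0_iff eq_commute[of 0])
    then show "Poly_Mapping.lookup p l * (\<Sum>r. Poly_Mapping.lookup q r when 0 = l + r)
        = (Poly_Mapping.lookup p l * Poly_Mapping.lookup q 0 when l = 0)"
      by (simp add: when_def)
  qed
  finally show ?thesis by simp
qed

lemma one_notin_gl_ideal: "1 \<notin> (gl_ideal :: (('n \<times> 'n) free_monoid \<Rightarrow>\<^sub>0 'k::comm_ring_1) set)"
proof
  have gen: "Poly_Mapping.lookup (free_gen i j :: _ \<Rightarrow>\<^sub>0 'k) 0 = 0" for i j :: 'n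
    by (simp add: free_gen_def zero_free_monoid_def lookup_single)
  have rel: "Poly_Mapping.lookup (gl_relator i j k l :: _ \<Rightarrow>\<^sub>0 'k) 0 = 0" for i j k l :: 'n
    by (simp add: gl_relator_def lookup_minus lookup_mult_0_free_monoid gen)
  have "p \<in> gl_ideal \<Longrightarrow> Poly_Mapping.lookup p 0 = 0" for p :: "('n \<times> 'n) free_monoid \<Rightarrow>\<^sub>0 'k"
    by (induction rule: gl_ideal.induct) (simp_all add: lookup_add lookup_mult_0_free_monoid rel)
  moreover assume "1 \<in> (gl_ideal :: (('n \<times> 'n) free_monoid \<Rightarrow>\<^sub>0 'k) set)"
  ultimately show False by fastforce
qed

text \<open>\<open>('n, 'k) ugl\<close> is $U(gl(N))$ over \<open>'k\<close> for $N$ = \<open>CARD('n)\<close>.\<close>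

quotient_type (overloaded) ('n, 'k) ugl =
  "('n \<times> 'n) free_monoid \<Rightarrow>\<^sub>0 ('k::comm_ring_1)" / "\<lambda>p q. p - q \<in> gl_ideal"
proof (rule equivpI)
  show "reflp (\<lambda>p q :: ('n \<times> 'n) free_monoid \<Rightarrow>\<^sub>0 'k. p - q \<in> gl_ideal)"
    by (rule reflpI) (simp add: gl_ideal.zero)
  show "symp (\<lambda>p q :: ('n \<times> 'n) free_monoid \<Rightarrow>\<^sub>0 'k. p - q \<in> gl_ideal)"
  proof (rule sympI)
    fix p q :: "('n \<times> 'n) free_monoid \<Rightarrow>\<^sub>0 'k"
    assume "p - q \<in> gl_ideal"
    then show "q - p \<in> gl_ideal"
      using gl_ideal_uminus[of "p - q"] by simp
  qed
  show "transp (\<lambda>p q :: ('n \<times> 'n) free_monoid \<Rightarrow>\<^sub>0 'k. p - q \<in> gl_ideal)"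
  proof (rule transpI)
    fix p q r :: "('n \<times> 'n) free_monoid \<Rightarrow>\<^sub>0 'k"
    assume "p - q \<in> gl_ideal" "q - r \<in> gl_ideal"
    then show "p - r \<in> gl_ideal"
      using gl_ideal_plus[of "p - q" "q - r"] by simp
  qed
qed

instantiation ugl :: (type, comm_ring_1) ring_1
begin

lift_definition zero_ugl :: "('a, 'b) ugl" is 0 .

lift_definition one_ugl :: "('a, 'b) ugl" is 1 .

lift_definition plus_ugl :: "('a, 'b) ugl \<Rightarrow> ('a, 'b) ugl \<Rightarrow> ('a, 'b) ugl" is "(+)"
proof -
  fix p p' q q' :: "('a \<times> 'a) free_monoid \<Rightarrow>\<^sub>0 'b"
  assume "p - p' \<in> gl_ideal" "q - q' \<in> gl_ideal"
  then show "p + q - (p' + q') \<in> gl_ideal"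
    using gl_ideal_plus[of "p - p'" "q - q'"] by (simp add: algebra_simps)
qed

lift_definition minus_ugl :: "('a, 'b) ugl \<Rightarrow> ('a, 'b) ugl \<Rightarrow> ('a, 'b) ugl" is "(-)"
proof -
  fix p p' q q' :: "('a \<times> 'a) free_monoid \<Rightarrow>\<^sub>0 'b"
  assume "p - p' \<in> gl_ideal" "q - q' \<in> gl_ideal"
  then show "p - q - (p' - q') \<in> gl_ideal"
    using gl_ideal_minus[of "p - p'" "q - q'"] by (simp add: algebra_simps)
qed

lift_definition uminus_ugl :: "('a, 'b) ugl \<Rightarrow> ('a, 'b) ugl" is uminus
proof -
  fix p p' :: "('a \<times> 'a) free_monoid \<Rightarrow>\<^sub>0 'b"
  assume "p - p' \<in> gl_ideal"
  then show "- p - (- p') \<in> gl_ideal"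
    using gl_ideal_uminus[of "p - p'"] by simp
qed

lift_definition times_ugl :: "('a, 'b) ugl \<Rightarrow> ('a, 'b) ugl \<Rightarrow> ('a, 'b) ugl" is "(*)"
proof -
  fix p p' q q' :: "('a \<times> 'a) free_monoid \<Rightarrow>\<^sub>0 'b"
  assume "p - p' \<in> gl_ideal" "q - q' \<in> gl_ideal"
  then have "(p - p') * q + p' * (q - q') \<in> gl_ideal"
    by (intro gl_ideal_plus gl_ideal_mult_left gl_ideal_mult_right)
  then show "p * q - p' * q' \<in> gl_ideal"
    by (simp add: algebra_simps)
qed

instance
proof
  show "(0 :: ('a, 'b) ugl) \<noteq> 1"
  proof transfer
    show "(0 :: ('a \<times> 'a) free_monoid \<Rightarrow>\<^sub>0 'b) - 1 \<notin> gl_ideal"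
      using one_notin_gl_ideal gl_ideal_uminus[of "- 1"] by fastforce
  qed
qed (transfer; simp add: algebra_simps gl_ideal.zero)+

end

lift_definition ugl_scalar :: "'k \<Rightarrow> ('n, 'k::comm_ring_1) ugl" is
  "\<lambda>c. Poly_Mapping.single 0 c" .

lift_definition ugl_gen :: "'n \<Rightarrow> 'n \<Rightarrow> ('n, 'k::comm_ring_1) ugl" is free_gen .

lemma ugl_gen_commutator:
  "ugl_gen i j * ugl_gen k l - ugl_gen k l * ugl_gen i j =
     (if k = j then ugl_gen i l else 0)
     - (if i = l then ugl_gen k j else (0 :: ('n, 'k::comm_ring_1) ugl))"
proof transfer
  fix i j k l :: 'n
  show "free_gen i j * free_gen k l - free_gen k l * free_gen i j
      - ((if k = j then free_gen i l else 0) - (if i = l then free_gen k j else 0))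
      \<in> (gl_ideal :: (('n \<times> 'n) free_monoid \<Rightarrow>\<^sub>0 'k) set)"
    using gl_ideal_relator[of i j k l] by (simp only: gl_relator_def)
qed

section \<open>The characteristic polynomial\<close>

text \<open>
  The index set $\{1,\dots,N\}$ is a finite linear order \<open>'n\<close>, used both for the basis of $V$ and for
  the tensor factors. Thus \<open>a :: 'n \<Rightarrow> 'n\<close> is a multi-index: it denotes the basis vector of
  $V^{\otimes N}$ with $e_{a(k)}$ in the \<open>k\<close>-th factor, and $R \otimes \mathrm{End}(V)^{\otimes N}$
  is the ring of matrices over \<open>R\<close> with rows and columns labelled by multi-indices.

  Polynomials in a central variable over a not necessarily commutative ring \<open>R\<close> are elements of
  the monoid ring \<open>nat \<Rightarrow>\<^sub>0 R\<close>, as the type \<open>poly\<close> has a product for commutative \<open>R\<close> only.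
\<close>

definition ugl_matrix :: "('n::finite, 'k::comm_ring_1) ugl ^ 'n ^ 'n" where
  "ugl_matrix = (\<chi> i j. ugl_gen i j)"

definition const_poly :: "'r \<Rightarrow> nat \<Rightarrow>\<^sub>0 'r::ring_1" where
  "const_poly c = Poly_Mapping.single 0 c"

definition var_poly :: "nat \<Rightarrow>\<^sub>0 'r::ring_1" where
  "var_poly = Poly_Mapping.single 1 1"

definition at_factor ::
  "'p \<Rightarrow> 'r::ring_1 ^ 'n::finite ^ 'n \<Rightarrow> 'r ^ ('p::finite \<Rightarrow> 'n) ^ ('p \<Rightarrow> 'n)" where
  "at_factor k X = (\<chi> a b. if \<forall>l. l \<noteq> k \<longrightarrow> a l = b l then X $ a k $ b k else 0)"

text \<open>
  A permutation \<open>\<sigma>\<close> moves the content of the \<open>k\<close>-th factor to the factor \<open>\<sigma> k\<close>, so it sends the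
  basis vector \<open>b\<close> to \<open>b \<circ> inv \<sigma>\<close>.
\<close>

definition permutation_operator ::
  "('p \<Rightarrow> 'p) \<Rightarrow> 'k::ring_1 ^ ('p::finite \<Rightarrow> 'n::finite) ^ ('p \<Rightarrow> 'n)" where
  "permutation_operator \<sigma> = (\<chi> a b. if a = b \<circ> inv \<sigma> then 1 else 0)"

definition skew_symmetrizer :: "'k::field_char_0 ^ ('p::finite \<Rightarrow> 'n::finite) ^ ('p \<Rightarrow> 'n)" where
  "skew_symmetrizer =
     mat (1 / fact CARD('p)) **
     (\<Sum>\<sigma> | \<sigma> permutes UNIV. mat (of_int (sign \<sigma>)) ** permutation_operator \<sigma>)"

text \<open>If \<open>k\<close> is the $r$-th element of \<open>'n\<close>, then \<open>card {..<k}\<close> is $r-1$.\<close>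

definition shifted_factor ::
  "'n \<Rightarrow> ('r::ring_1 ^ 'n::{finite,linorder}) ^ 'n::{finite,linorder} \<Rightarrow> (nat \<Rightarrow>\<^sub>0 'r) ^ ('n \<Rightarrow> 'n) ^ ('n \<Rightarrow> 'n)" where
  "shifted_factor k X =
     mat (var_poly - of_nat (card {..<k})) - at_factor k (map_matrix const_poly X)"

definition char_poly_ugl :: "nat \<Rightarrow>\<^sub>0 ('n::{finite,linorder}, 'k::field_char_0) ugl" where
  "char_poly_ugl = trace
     (map_matrix (\<lambda>c. const_poly (ugl_scalar c)) (skew_symmetrizer :: 'k ^ ('n \<Rightarrow> 'n) ^ ('n \<Rightarrow> 'n)) **
      foldr (**) (map (\<lambda>k. shifted_factor k ugl_matrix) (sorted_list_of_set UNIV)) (mat 1))"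

primrec matrix_power :: "'r::ring_1 ^ 'n::finite ^ 'n \<Rightarrow> nat \<Rightarrow> 'r ^ 'n ^ 'n" where
  "matrix_power X 0 = mat 1"
| "matrix_power X (Suc d) = X ** matrix_power X d"

text \<open>
  Coefficients act entrywise from the left; for \<open>char_poly_ugl\<close> they are central, so the side is
  immaterial.
\<close>

definition poly_at_matrix :: "(nat \<Rightarrow>\<^sub>0 'r) \<Rightarrow> 'r::ring_1 ^ 'n::finite ^ 'n \<Rightarrow> 'r ^ 'n ^ 'n" where
  "poly_at_matrix q X =
     (\<Sum>d \<in> Poly_Mapping.keys q. mat (Poly_Mapping.lookup q d) ** matrix_power X d)"

end

theory Submission
  imports Defs
begin

text \<open>
  Put $L_k = (t-k+1)I - M$. The proof follows Laplace's derivation of the Cayley-Hamilton theorem, with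
  $\mathcal Q(t)$ as the determinant of $tI - M$.
  
  The shifts in $\mathcal Q$ are chosen so that skew-symmetrizing the product of the $(L_k)_k$ in its columns makes it skew
  symmetric in its rows as well. For two neighbouring factors this is a short computation from the commutation relations
  (\<open>pencil_skew\<close>), and adjacent transpositions generate the symmetric group (\<open>skew_chain_row\<close>). As the space of skew
  tensors in $V^{\otimes N}$ is one-dimensional, all the skew-symmetrized matrix elements are $0$ or, up to sign, the single row
  determinant $\sum_\sigma \mathrm{sgn}(\sigma) (L_1)_{1,\sigma(1)} \cdots (L_N)_{N,\sigma(N)}$, and the trace that defines
  $\mathcal Q(t)$ equals it too (\<open>char_poly_ugl_eq_row_det\<close>).
  
  Splitting off the first factor, which is $tI - M$ itself, gives a matrix $B(t)$ with $(tI - M) B(t) = \mathcal Q(t) I$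
  (\<open>row_expansion\<close>): two equal rows give $0$ off the diagonal. Comparing coefficients, $\sum_d M^d \mathcal Q_d$ telescopes to
  $0$. To bring the coefficients to the left of the powers of $M$ one needs them to be central (\<open>row_det_central\<close>); this
  holds because the trace of a permutation times a product of the $(L_k)_k$ is invariant under the adjoint action.
\<close>

section \<open>Alternating functions on a finite linear order\<close>

lemma sorted_list_of_set_UNIV_split_adjacent:
  fixes p q :: "'n::{finite,linorder}"
  assumes "p < q" and gap: "{p<..<q} = {}"
  obtains us vs where "sorted_list_of_set (UNIV :: 'n set) = us @ p # q # vs"
    and "p \<notin> set us" "q \<notin> set us" "p \<notin> set vs" "q \<notin> set vs"
proof -
  let ?xs = "sorted_list_of_set (UNIV :: 'n set)"
  have "p \<in> set ?xs" by simp
  then obtain us ws where s: "?xs = us @ p # ws" by (meson split_list)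
  have srt: "sorted_wrt (<) ?xs" and st: "set ?xs = UNIV"
    by (simp_all add: strict_sorted_list_of_set)
  have lt: "\<And>x. x \<in> set us \<Longrightarrow> x < p" and gt: "\<And>x. x \<in> set ws \<Longrightarrow> p < x"
    using srt unfolding s by (auto simp: sorted_wrt_append)
  have "q \<in> set us \<union> {p} \<union> set ws" using st unfolding s by auto
  then have qws: "q \<in> set ws" using lt \<open>p < q\<close> by (metis Un_iff order.asym singletonD less_irrefl)
  then obtain r vs where ws: "ws = r # vs" by (cases ws) auto
  have rvs: "\<And>x. x \<in> set vs \<Longrightarrow> r < x" using srt unfolding s ws by (auto simp: sorted_wrt_append)
  have "r = q"
  proof (rule ccontr)
    assume "r \<noteq> q"
    then have "r < q" using qws rvs ws by auto
    moreover have "p < r" using gt ws by auto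
    ultimately show False using gap by auto
  qed
  show ?thesis
  proof
    show "?xs = us @ p # q # vs" using s ws \<open>r = q\<close> by simp
    show "p \<notin> set us" using lt by auto
    show "q \<notin> set us" using lt \<open>p < q\<close> by (metis order.asym)
    show "p \<notin> set vs" using rvs \<open>r = q\<close> \<open>p < q\<close> by (metis order.asym)
    show "q \<notin> set vs" using rvs \<open>r = q\<close> by auto
  qed
qed

text \<open>
  Two neighbouring tensor factors are the only ones that can be compared directly. If \<open>r\<close> lies strictly between
  \<open>p\<close> and \<open>q\<close>, then $(p\,q) = (p\,r)(r\,q)(p\,r)$ splits a transposition into three transpositions over
  smaller gaps, and three sign changes make one.
\<close>

lemma alternating_of_adjacent_transpositions:
  fixes f :: "('n::{finite,linorder} \<Rightarrow> 'm) \<Rightarrow> 'r::ring_1"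
  assumes adj: "\<And>p q a. p < q \<Longrightarrow> {p<..<q} = {} \<Longrightarrow> f (a \<circ> Transposition.transpose p q) = - f a"
    and "p < q"
  shows "f (a \<circ> Transposition.transpose p q) = - f a"
  using \<open>p < q\<close>
proof (induction "card {p<..<q}" arbitrary: p q a rule: less_induct)
  case less
  show ?case
  proof (cases "{p<..<q} = {}")
    case True
    then show ?thesis using adj less.prems by blast
  next
    case False
    then obtain r where r: "p < r" "r < q" by auto
    have 1: "card {p<..<r} < card {p<..<q}"
      by (rule psubset_card_mono) (use r in auto)
    have 2: "card {r<..<q} < card {p<..<q}"
      by (rule psubset_card_mono) (use r in auto)
    have "Transposition.transpose p q =
        Transposition.transpose p r \<circ> Transposition.transpose r q \<circ> Transposition.transpose p r"
      using r by (auto simp: fun_eq_iff Transposition.transpose_def)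
    then have "f (a \<circ> Transposition.transpose p q) =
        f (a \<circ> Transposition.transpose p r \<circ> Transposition.transpose r q \<circ> Transposition.transpose p r)"
      by (simp add: comp_assoc)
    also have "\<dots> = - f a"
      using less.hyps[OF 1] less.hyps[OF 2] r by simp
    finally show ?thesis .
  qed
qed

lemma sign_rule_of_adjacent_transpositions:
  fixes f :: "('n::{finite,linorder} \<Rightarrow> 'm) \<Rightarrow> 'r::ring_1"
  assumes adj: "\<And>p q a. p < q \<Longrightarrow> {p<..<q} = {} \<Longrightarrow> f (a \<circ> Transposition.transpose p q) = - f a"
    and "\<tau> permutes UNIV"
  shows "f (a \<circ> \<tau>) = of_int (sign \<tau>) * f a"
  using assms(2) finite_class.finite_UNIV
proof (induction \<tau> arbitrary: a rule: permutes_induct)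
  case id
  then show ?case by simp
next
  case (swap p q \<tau>)
  have "f (a \<circ> Transposition.transpose p q) = - f a"
  proof (cases p q rule: linorder_cases)
    case less
    then show ?thesis using alternating_of_adjacent_transpositions[of f, OF adj] by blast
  next
    case greater
    then show ?thesis using alternating_of_adjacent_transpositions[of f, OF adj, of q p] by (simp add: transpose_commute)
  qed (use swap in auto)
  moreover have "sign (Transposition.transpose p q \<circ> \<tau>) = - sign \<tau>"
    using swap by (simp add: sign_compose sign_swap_id permutation_swap_id
        permutes_imp_permutation)
  ultimately show ?case
    using swap.IH[of "a \<circ> Transposition.transpose p q"] by (simp only: comp_assoc of_int_minus) simp
qed

section \<open>Ordered products in the entries of the shifted matrices\<close>

text \<open>
  The intended ring is $U(gl(N))[t]$. It is assumed to be torsion free so that $2$ and $N!$ can be cancelled in a ring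
  without scalars.
\<close>

locale gl_pencil =
  fixes e :: "'n::{finite,linorder} \<Rightarrow> 'n \<Rightarrow> 'r::ring_1" and t :: 'r
  assumes commutator: "e i j * e k l - e k l * e i j =
      (if k = j then e i l else 0) - (if i = l then e k j else 0)"
    and t_commute: "t * e i j = e i j * t"
    and torsion_free: "of_nat n * x = (0::'r) \<Longrightarrow> n = 0 \<or> x = 0"
begin

text \<open>
  The matrix $(t-k+1)I - M$ that occupies the \<open>k\<close>-th tensor factor.
\<close>

definition pencil :: "'n \<Rightarrow> 'n \<Rightarrow> 'n \<Rightarrow> 'r" where
  "pencil k i j = (if i = j then t - of_nat (card {..<k}) else 0) - e i j"

text \<open>
  For the sorted list of all factors, \<open>chain\<close> is the matrix element, from row \<open>a\<close> to column \<open>b\<close>, of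
  $(tI-M_1)((t-1)I-M_2)\cdots((t-N+1)I-M_N)$. Shorter lists occur when this product is split.
\<close>

definition chain :: "'n list \<Rightarrow> ('n \<Rightarrow> 'n) \<Rightarrow> ('n \<Rightarrow> 'n) \<Rightarrow> 'r" where
  "chain ks a b = prod_list (map (\<lambda>k. pencil k (a k) (b k)) ks)"

text \<open>
  Up to $N!$, the matrix element of the product of all the factors with the skew-symmetrizer on its right.
\<close>

definition skew_chain :: "('n \<Rightarrow> 'n) \<Rightarrow> ('n \<Rightarrow> 'n) \<Rightarrow> 'r" where
  "skew_chain a b =
     (\<Sum>\<sigma> | \<sigma> permutes UNIV. of_int (sign \<sigma>) * chain (sorted_list_of_set UNIV) a (b \<circ> \<sigma>))"

lemma chain_simps [simp]:
  "chain [] a b = 1"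
  "chain (k # ks) a b = pencil k (a k) (b k) * chain ks a b"
  "chain (ks @ ls) a b = chain ks a b * chain ls a b"
  by (simp_all add: chain_def)

lemma chain_cong:
  "(\<And>k. k \<in> set ks \<Longrightarrow> a k = a' k \<and> b k = b' k) \<Longrightarrow> chain ks a b = chain ks a' b'"
  unfolding chain_def by (intro arg_cong[where f = prod_list] map_cong) auto

lemma self_negative_eq_0: "x = - x \<Longrightarrow> x = (0::'r)"
  using torsion_free[of 2 x] by (simp add: mult_2 eq_neg_iff_add_eq_0)

section \<open>Skew symmetry in the rows\<close>

text \<open>
  Neighbouring factors are shifted by $1$ against each other, and this produces the terms linear in \<open>e\<close>. They have
  the same shape as the commutator of two generators, which is why they cancel after skew-symmetrization.
\<close>

lemma pencil_exchange:
  assumes "card {..<q} = Suc (card {..<p})"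
  shows "pencil p i k * pencil q j l - pencil p j l * pencil q i k =
    e i k * e j l - e j l * e i k
    + ((if j = l then e i k else 0) - (if i = k then e j l else 0))"
proof -
  define s where "s = t - of_nat (card {..<p})"
  have s: "s * e i j = e i j * s" for i j
    by (simp add: s_def algebra_simps t_commute mult_of_nat_commute)
  have p: "pencil p i j = (if i = j then s else 0) - e i j"
    and q: "pencil q i j = (if i = j then s - 1 else 0) - e i j" for i j
    by (simp_all add: pencil_def s_def assms)
  show ?thesis unfolding p q by (simp add: algebra_simps s)
qed

text \<open>
  The case $N = 2$ of the mechanism: skew symmetry in the columns \<open>k\<close>, \<open>l\<close> forces skew symmetry in the rows \<open>i\<close>, \<open>j\<close>.
  In R-matrix language, $L_1(t) L_2(t-1) P_- = P_- L_1(t) L_2(t-1) P_-$ for $L(t) = tI - M$; with the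
  shifts exchanged this fails and the product has to be skew-symmetrized in the rows instead.
\<close>

lemma pencil_skew:
  assumes "card {..<q} = Suc (card {..<p})"
  shows "pencil p i k * pencil q j l - pencil p i l * pencil q j k
       + pencil p j k * pencil q i l - pencil p j l * pencil q i k = 0"
proof -
  have "pencil p i k * pencil q j l - pencil p i l * pencil q j k
       + pencil p j k * pencil q i l - pencil p j l * pencil q i k =
    (pencil p i k * pencil q j l - pencil p j l * pencil q i k)
      - (pencil p i l * pencil q j k - pencil p j k * pencil q i l)" by simp
  also have "\<dots> = 0"
    unfolding pencil_exchange[OF assms] commutator by auto
  finally show ?thesis .
qed

lemma chain_skew_adjacent:
  fixes p q :: 'n
  assumes "p < q" "{p<..<q} = {}"
  defines "s \<equiv> Transposition.transpose p q" and "ks \<equiv> sorted_list_of_set UNIV"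
  shows "chain ks a c - chain ks a (c \<circ> s) + chain ks (a \<circ> s) c - chain ks (a \<circ> s) (c \<circ> s) = 0"
proof -
  obtain us vs where ks: "ks = us @ p # q # vs"
    and notin: "p \<notin> set us" "q \<notin> set us" "p \<notin> set vs" "q \<notin> set vs"
    using sorted_list_of_set_UNIV_split_adjacent[OF assms(1,2)] unfolding ks_def by metis
  have "{..<q} = insert p {..<p}" using assms(1,2) by (auto simp: not_less dest: leD)
      (metis (no_types) emptyE greaterThanLessThan_iff linorder_neqE)
  then have card: "card {..<q} = Suc (card {..<p})" by simp
  have s_id: "s k = k" if "k \<noteq> p" "k \<noteq> q" for k using that by (simp add: s_def)
  have us: "chain us (a \<circ> s) c' = chain us a c'" "chain us a' (c \<circ> s) = chain us a' c" for a' c'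
    by (rule chain_cong; use notin s_id in force)+
  have vs: "chain vs (a \<circ> s) c' = chain vs a c'" "chain vs a' (c \<circ> s) = chain vs a' c" for a' c'
    by (rule chain_cong; use notin s_id in force)+
  have s: "s p = q" "s q = p" by (simp_all add: s_def)
  have "chain ks a c - chain ks a (c \<circ> s) + chain ks (a \<circ> s) c - chain ks (a \<circ> s) (c \<circ> s) =
    chain us a c * (pencil p (a p) (c p) * pencil q (a q) (c q) - pencil p (a p) (c q) * pencil q (a q) (c p)
       + pencil p (a q) (c p) * pencil q (a p) (c q) - pencil p (a q) (c q) * pencil q (a p) (c p))
      * chain vs a c"
    by (simp add: ks us vs s algebra_simps)
  then show ?thesis by (simp add: pencil_skew[OF card])
qed

lemma skew_chain_col:
  assumes "\<tau> permutes UNIV"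
  shows "skew_chain a (b \<circ> \<tau>) = of_int (sign \<tau>) * skew_chain a b"
proof -
  have sg: "sign (\<tau> \<circ> \<sigma>) = sign \<tau> * sign \<sigma>" if "\<sigma> permutes UNIV" for \<sigma>
    using assms that by (simp add: sign_compose permutes_imp_permutation)
  have "of_int (sign \<tau>) * skew_chain a b = (\<Sum>\<sigma> | \<sigma> permutes UNIV. of_int (sign \<tau>) *
      (of_int (sign (\<tau> \<circ> \<sigma>)) * chain (sorted_list_of_set UNIV) a (b \<circ> (\<tau> \<circ> \<sigma>))))"
    unfolding skew_chain_def sum_distrib_left
    by (subst setum_permutations_compose_left[OF assms]) rule
  also have "\<dots> = skew_chain a (b \<circ> \<tau>)"
    unfolding skew_chain_def
  proof (rule sum.cong[OF refl])
    fix \<sigma> :: "'n \<Rightarrow> 'n" assume "\<sigma> \<in> {\<sigma>. \<sigma> permutes UNIV}"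
    then have "of_int (sign \<tau>) * (of_int (sign (\<tau> \<circ> \<sigma>)) :: 'r) = of_int (sign \<sigma>)"
      by (simp add: sg flip: of_int_mult mult.assoc)
    then show "of_int (sign \<tau>) * (of_int (sign (\<tau> \<circ> \<sigma>)) * chain (sorted_list_of_set UNIV) a (b \<circ> (\<tau> \<circ> \<sigma>))) =
         of_int (sign \<sigma>) * chain (sorted_list_of_set UNIV) a (b \<circ> \<tau> \<circ> \<sigma>)"
      by (simp add: comp_assoc flip: mult.assoc)
  qed
  finally show ?thesis by simp
qed

text \<open>
  \<open>\<tau>\<close> permutes the tensor factors here, whereas in \<open>skew_chain_col\<close> it permutes the entries of a multi-index. The
  row rule needs this version, as a transposition of neighbouring factors moves the columns by position.
\<close>

lemma skew_chain_compose_right: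
  assumes "\<tau> permutes UNIV"
  shows "(\<Sum>\<sigma> | \<sigma> permutes UNIV. of_int (sign \<sigma>) * chain (sorted_list_of_set UNIV) a (b \<circ> \<sigma> \<circ> \<tau>))
    = of_int (sign \<tau>) * skew_chain a b"
proof -
  have sg: "sign (\<sigma> \<circ> \<tau>) = sign \<tau> * sign \<sigma>" if "\<sigma> permutes UNIV" for \<sigma>
    using assms that by (simp add: sign_compose permutes_imp_permutation mult.commute)
  have "of_int (sign \<tau>) * skew_chain a b = (\<Sum>\<sigma> | \<sigma> permutes UNIV. of_int (sign \<tau>) *
      (of_int (sign (\<sigma> \<circ> \<tau>)) * chain (sorted_list_of_set UNIV) a (b \<circ> (\<sigma> \<circ> \<tau>))))"
    unfolding skew_chain_def sum_distrib_left
    by (subst sum_permutations_compose_right[OF assms]) rule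
  also have "\<dots> = (\<Sum>\<sigma> | \<sigma> permutes UNIV. of_int (sign \<sigma>) * chain (sorted_list_of_set UNIV) a (b \<circ> \<sigma> \<circ> \<tau>))"
  proof (rule sum.cong[OF refl])
    fix \<sigma> :: "'n \<Rightarrow> 'n" assume "\<sigma> \<in> {\<sigma>. \<sigma> permutes UNIV}"
    then have "of_int (sign \<tau>) * (of_int (sign (\<sigma> \<circ> \<tau>)) :: 'r) = of_int (sign \<sigma>)"
      by (simp add: sg flip: of_int_mult)
    then show "of_int (sign \<tau>) * (of_int (sign (\<sigma> \<circ> \<tau>)) * chain (sorted_list_of_set UNIV) a (b \<circ> (\<sigma> \<circ> \<tau>))) =
         of_int (sign \<sigma>) * chain (sorted_list_of_set UNIV) a (b \<circ> \<sigma> \<circ> \<tau>)"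
      by (simp add: comp_assoc flip: mult.assoc)
  qed
  finally show ?thesis by simp
qed

text \<open>
  Averaging \<open>chain_skew_adjacent\<close> over the columns pairs \<open>\<sigma>\<close> with \<open>\<sigma>\<close> composed with the transposition, so every term
  is counted twice and $2$ has to be cancelled.
\<close>

lemma skew_chain_row_adjacent:
  fixes p q :: 'n
  assumes "p < q" "{p<..<q} = {}"
  shows "skew_chain (a \<circ> Transposition.transpose p q) b = - skew_chain a b"
proof -
  define s where "s = Transposition.transpose p q"
  let ?ks = "sorted_list_of_set (UNIV :: 'n set)"
  have s: "s permutes UNIV" and sgn: "sign s = -1"
    using assms(1) by (simp_all add: s_def permutes_swap_id sign_swap_id)
  have "0 = (\<Sum>\<sigma> | \<sigma> permutes UNIV. of_int (sign \<sigma>) *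
     (chain ?ks a (b \<circ> \<sigma>) - chain ?ks a (b \<circ> \<sigma> \<circ> s) + chain ?ks (a \<circ> s) (b \<circ> \<sigma>)
        - chain ?ks (a \<circ> s) (b \<circ> \<sigma> \<circ> s)))"
    using chain_skew_adjacent[OF assms] by (simp add: s_def)
  also have "\<dots> = skew_chain a b - of_int (sign s) * skew_chain a b
      + skew_chain (a \<circ> s) b - of_int (sign s) * skew_chain (a \<circ> s) b"
    unfolding skew_chain_compose_right[OF s, symmetric]
    by (simp add: skew_chain_def sum.distrib sum_subtractf algebra_simps)
  finally have "of_nat 2 * (skew_chain a b + skew_chain (a \<circ> s) b) = 0"
    by (simp add: sgn mult_2 add_ac)
  then show ?thesis
    using torsion_free by (fastforce simp: s_def eq_neg_iff_add_eq_0 add.commute)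
qed

lemma skew_chain_row:
  assumes "\<tau> permutes UNIV"
  shows "skew_chain (a \<circ> \<tau>) b = of_int (sign \<tau>) * skew_chain a b"
  using sign_rule_of_adjacent_transpositions[of "\<lambda>a. skew_chain a b"] skew_chain_row_adjacent assms by blast

text \<open>
  Exchanging two equal rows changes nothing but the sign.
\<close>

lemma skew_chain_not_inj:
  assumes "\<not> inj a"
  shows "skew_chain a b = 0"
proof -
  obtain p q where pq: "a p = a q" "p \<noteq> q" using assms by (auto simp: inj_def)
  have "a \<circ> Transposition.transpose p q = a"
    using pq by (auto simp: fun_eq_iff Transposition.transpose_def)
  then have "skew_chain a b = - skew_chain a b"
    using skew_chain_row[of "Transposition.transpose p q" a b] pq
    by (simp add: permutes_swap_id sign_swap_id)
  then show ?thesis by (rule self_negative_eq_0)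
qed

section \<open>The characteristic polynomial as a row determinant\<close>

definition row_det :: 'r where "row_det = skew_chain id id"

lemma skew_chain_row_det:
  assumes "a permutes UNIV"
  shows "skew_chain a id = of_int (sign a) * row_det"
  using skew_chain_row[OF assms, of id id] by (simp add: row_det_def)

text \<open>
  The left side is the trace of $N!$ times the skew-symmetrized product. Only the multi-indices without
  repetition contribute, and for those the signs of the rows and of the columns cancel.
\<close>

lemma sum_skew_chain_diagonal: "(\<Sum>b\<in>UNIV. skew_chain b b) = of_nat (fact CARD('n)) * row_det"
proof -
  have diag: "skew_chain b b = row_det" if "b permutes UNIV" for b
  proof -
    have "skew_chain b b = of_int (sign b) * (of_int (sign b) * row_det)"
      using skew_chain_row[OF that, of id b] skew_chain_col[OF that, of id id] by (simp add: row_det_def)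
    also have "\<dots> = of_int (sign b * sign b) * row_det"
      by (simp only: of_int_mult mult.assoc)
    finally show ?thesis by simp
  qed
  have "(\<Sum>b\<in>UNIV. skew_chain b b) = (\<Sum>b | b permutes UNIV. skew_chain b b)"
  proof (rule sum.mono_neutral_right)
    have "skew_chain b b = 0" if "\<not> b permutes UNIV" for b
      using that skew_chain_not_inj[of b b] bij_imp_permutes[of b UNIV] finite_UNIV_inj_surj[of b]
      by (auto simp: bij_def)
    then show "\<forall>b\<in>UNIV - {b. b permutes UNIV}. skew_chain b b = 0" by simp
  qed auto
  also have "\<dots> = of_nat (card {b. b permutes (UNIV :: 'n set)}) * row_det"
    by (simp add: diag)
  also have "card {b. b permutes (UNIV :: 'n set)} = fact CARD('n)"
    by (simp add: card_permutations)
  finally show ?thesis by simp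
qed

lemma commutator_pencil:
  "e i j * pencil k x y - pencil k x y * e i j =
     (if x = j then pencil k i y else 0) - (if y = i then pencil k x j else 0)"
proof -
  have "e i j * (if x = y then t - of_nat n else 0) = (if x = y then t - of_nat n else 0) * e i j" for n
    by (simp add: right_diff_distrib left_diff_distrib t_commute mult_of_nat_commute)
  then have "e i j * pencil k x y - pencil k x y * e i j = e x y * e i j - e i j * e x y"
    by (simp add: pencil_def right_diff_distrib left_diff_distrib)
  also have "\<dots> = (if x = j then pencil k i y else 0) - (if y = i then pencil k x j else 0)"
    unfolding commutator by (auto simp: pencil_def)
  finally show ?thesis .
qed

section \<open>Centrality\<close>

text \<open>
  The commutator with a generator is a derivation, and it acts on each matrix entry through the row and the column
  index as the adjoint action does. The scalar part of the entries plays along because the identity matrix is invariant.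
\<close>

lemma commutator_chain:
  assumes "distinct ks"
  shows "e i j * chain ks a b - chain ks a b * e i j =
    (\<Sum>m\<in>set ks. (if a m = j then chain ks (a(m := i)) b else 0)
                - (if b m = i then chain ks a (b(m := j)) else 0))"
  using assms
proof (induction ks)
  case Nil
  then show ?case by simp
next
  case (Cons k ks)
  have k: "chain ks (a(k := x)) b = chain ks a b" "chain ks a (b(k := x)) = chain ks a b" for x
    by (rule chain_cong; use Cons.prems in auto)+
  let ?P = "pencil k (a k) (b k)" and ?x = "e i j"
  have "?x * chain (k # ks) a b - chain (k # ks) a b * ?x =
    (?x * ?P - ?P * ?x) * chain ks a b + ?P * (?x * chain ks a b - chain ks a b * ?x)"
    by (simp add: algebra_simps)
  also have "(?x * ?P - ?P * ?x) * chain ks a b =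
     (if a k = j then chain (k # ks) (a(k := i)) b else 0)
                - (if b k = i then chain (k # ks) a (b(k := j)) else 0)"
    by (simp add: commutator_pencil k algebra_simps)
  also have "?P * (?x * chain ks a b - chain ks a b * ?x) =
    (\<Sum>m\<in>set ks. (if a m = j then chain (k # ks) (a(m := i)) b else 0)
                - (if b m = i then chain (k # ks) a (b(m := j)) else 0))"
  proof -
    have "?P * (?x * chain ks a b - chain ks a b * ?x) = 
      (\<Sum>m\<in>set ks. ?P * ((if a m = j then chain ks (a(m := i)) b else 0)
                - (if b m = i then chain ks a (b(m := j)) else 0)))"
      using Cons by (simp add: sum_distrib_left)
    also have "\<dots> = (\<Sum>m\<in>set ks. (if a m = j then chain (k # ks) (a(m := i)) b else 0)
                - (if b m = i then chain (k # ks) a (b(m := j)) else 0))"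
      by (rule sum.cong[OF refl]) (use Cons.prems in \<open>auto simp: algebra_simps\<close>)
    finally show ?thesis .
  qed
  finally show ?case using Cons.prems by simp
qed

text \<open>
  The trace form of the determinant is used because there the adjoint action visibly vanishes: for a fixed \<open>\<sigma>\<close>, replacing
  the row index in factor \<open>\<sigma> m\<close> and replacing the column index in factor \<open>m\<close> are two descriptions of the same
  terms, since both indices are the value of \<open>b\<close> at \<open>\<sigma> m\<close>. The two contributions have opposite signs.
\<close>

lemma row_det_central: "e i j * row_det = row_det * e i j"
proof -
  let ?ks = "sorted_list_of_set (UNIV :: 'n set)" and ?x = "e i j"
  have "(\<Sum>b\<in>UNIV. ?x * chain ?ks b (b \<circ> \<sigma>) - chain ?ks b (b \<circ> \<sigma>) * ?x) = 0"
    if \<sigma>: "\<sigma> permutes UNIV" for \<sigma>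
  proof -
    have inj: "\<sigma> k = \<sigma> m \<longleftrightarrow> k = m" for k m using permutes_inj[OF \<sigma>] by (auto simp: inj_def)
    have "(\<Sum>b\<in>UNIV. ?x * chain ?ks b (b \<circ> \<sigma>) - chain ?ks b (b \<circ> \<sigma>) * ?x) =
      (\<Sum>b\<in>UNIV. \<Sum>m\<in>UNIV. if b m = j then chain ?ks (b(m := i)) (b \<circ> \<sigma>) else 0)
      - (\<Sum>b\<in>UNIV. \<Sum>m\<in>UNIV. if b (\<sigma> m) = i then chain ?ks b ((b \<circ> \<sigma>)(m := j)) else 0)"
      by (simp add: commutator_chain sum_subtractf)
    also have "(\<Sum>b\<in>UNIV. \<Sum>m\<in>UNIV. if b m = j then chain ?ks (b(m := i)) (b \<circ> \<sigma>) else 0)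
      = (\<Sum>b\<in>UNIV. \<Sum>m\<in>UNIV. if b (\<sigma> m) = j then chain ?ks (b(\<sigma> m := i)) (b \<circ> \<sigma>) else 0)"
      by (rule sum.cong[OF refl], subst sum.permute[OF \<sigma>]) (simp add: o_def [abs_def])
    also have "\<dots> = (\<Sum>m\<in>UNIV. \<Sum>b | b (\<sigma> m) = j. chain ?ks (b(\<sigma> m := i)) (b \<circ> \<sigma>))"
      by (subst sum.swap) (simp add: sum.If_cases)
    also have "\<dots> = (\<Sum>m\<in>UNIV. \<Sum>b | b (\<sigma> m) = i. chain ?ks b ((b \<circ> \<sigma>)(m := j)))"
    proof (rule sum.cong[OF refl])
      fix m
      show "(\<Sum>b | b (\<sigma> m) = j. chain ?ks (b(\<sigma> m := i)) (b \<circ> \<sigma>)) =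
        (\<Sum>b | b (\<sigma> m) = i. chain ?ks b ((b \<circ> \<sigma>)(m := j)))"
        by (rule sum.reindex_bij_witness[where i = "\<lambda>b. b(\<sigma> m := j)" and j = "\<lambda>b. b(\<sigma> m := i)"])
          (auto simp: inj fun_eq_iff intro!: arg_cong2[where f = "chain ?ks"])
    qed
    also have "\<dots> = (\<Sum>b\<in>UNIV. \<Sum>m\<in>UNIV. if b (\<sigma> m) = i then chain ?ks b ((b \<circ> \<sigma>)(m := j)) else 0)"
      by (subst sum.swap) (simp add: sum.If_cases)
    finally show ?thesis by (simp only: diff_self)
  qed
  note vanish = this
  have pull: "?x * (of_int c * C) - of_int c * C * ?x = of_int c * (?x * C - C * ?x)" for c C
    using mult_of_int_commute[of c ?x] by (simp add: right_diff_distrib flip: mult.assoc)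
  have "?x * (\<Sum>b\<in>UNIV. skew_chain b b) - (\<Sum>b\<in>UNIV. skew_chain b b) * ?x =
    (\<Sum>b\<in>UNIV. \<Sum>\<sigma> | \<sigma> permutes UNIV. of_int (sign \<sigma>) *
       (?x * chain ?ks b (b \<circ> \<sigma>) - chain ?ks b (b \<circ> \<sigma>) * ?x))"
    unfolding skew_chain_def sum_distrib_left sum_distrib_right sum_subtractf[symmetric]
    by (intro sum.cong[OF refl] pull)
  also have "\<dots> = (\<Sum>\<sigma> | \<sigma> permutes UNIV. of_int (sign \<sigma>) * (\<Sum>b\<in>UNIV.
       ?x * chain ?ks b (b \<circ> \<sigma>) - chain ?ks b (b \<circ> \<sigma>) * ?x))"
    by (subst sum.swap) (simp add: sum_distrib_left)
  also have "\<dots> = 0" by (rule sum.neutral) (simp add: vanish)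
  finally have "of_nat (fact CARD('n)) * (?x * row_det - row_det * ?x) = 0"
    unfolding sum_skew_chain_diagonal
    using mult_of_nat_commute[of "fact CARD('n)" ?x] by (simp add: right_diff_distrib flip: mult.assoc)
  then show ?thesis using torsion_free by fastforce
qed

section \<open>Expansion along the first factor\<close>

text \<open>
  Laplace expansion, with \<open>B\<close> in the role of the adjugate. The factor split off is the first one because it is the one
  that carries no shift and can be split off from the left.
\<close>

lemma row_expansion:
  obtains B where "\<And>i k. (\<Sum>j\<in>UNIV. ((if i = j then t else 0) - e i j) * B j k) =
    (if i = k then row_det else 0)"
proof -
  obtain z ks where ks: "sorted_list_of_set (UNIV :: 'n set) = z # ks"
    by (cases "sorted_list_of_set (UNIV :: 'n set)") auto
  have "sorted_wrt (<) (z # ks)" and st: "set (z # ks) = UNIV"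
    using strict_sorted_list_of_set[of "UNIV :: 'n set"] by (simp_all flip: ks)
  then have lt: "\<And>k. k \<in> set ks \<Longrightarrow> z < k" by simp
  then have z: "z \<notin> set ks" by auto
  have "k \<ge> z" for k using st lt[of k] by (cases "k = z") (auto simp: set_eq_iff)
  then have "{..<z} = {}" by (metis lessThan_iff less_le_not_le equals0I)
  then have first: "pencil z i j = (if i = j then t else 0) - e i j" for i j
    by (simp add: pencil_def)
  define s where "s k = Transposition.transpose z k" for k :: 'n
  define B where "B j k = of_int (sign (s k)) *
    (\<Sum>\<sigma> | \<sigma> permutes UNIV \<and> \<sigma> z = j. of_int (sign \<sigma>) * chain ks (s k) \<sigma>)" for j k
  have "(\<Sum>j\<in>UNIV. pencil z i j * B j k) = (if i = k then row_det else 0)" for i k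
  proof -
    \<comment> \<open>These rows form the permutation \<open>s k\<close> if \<open>i = k\<close>, and otherwise the row \<open>i\<close> occurs twice.\<close>
    let ?a = "(s k)(z := i)"
    have pull: "P * (of_int c * X) = of_int c * (P * X)" for c P X
      by (metis mult.assoc mult_of_int_commute)
    have ch: "chain ks ?a \<sigma> = chain ks (s k) \<sigma>" for \<sigma>
      by (rule chain_cong) (use z in auto)
    have "(\<Sum>j\<in>UNIV. pencil z i j * B j k) = of_int (sign (s k)) * (\<Sum>j\<in>UNIV.
      \<Sum>\<sigma> | \<sigma> permutes UNIV \<and> \<sigma> z = j. of_int (sign \<sigma>) * (pencil z i (\<sigma> z) * chain ks (s k) \<sigma>))"
    proof (subst sum_distrib_left, rule sum.cong[OF refl])
      fix j
      show "pencil z i j * B j k = of_int (sign (s k)) *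
        (\<Sum>\<sigma> | \<sigma> permutes UNIV \<and> \<sigma> z = j. of_int (sign \<sigma>) * (pencil z i (\<sigma> z) * chain ks (s k) \<sigma>))"
        unfolding B_def
        by (subst pull, subst sum_distrib_left) (auto intro!: arg_cong2[where f = "(*)"] sum.cong pull)
    qed
    also have "\<dots> = of_int (sign (s k)) * skew_chain ?a id"
      unfolding skew_chain_def ks
      by (subst sum.group[symmetric, where g = "\<lambda>\<sigma>. \<sigma> z" and T = UNIV]) (auto simp: ch)
    also have "\<dots> = (if i = k then row_det else 0)"
    proof (cases "i = k")
      case True
      then have "?a = s k" by (auto simp: s_def)
      moreover have "s k permutes UNIV" by (simp add: s_def permutes_swap_id)
      ultimately show ?thesis using True
        by (simp add: skew_chain_row_det flip: mult.assoc of_int_mult)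
    next
      case False
      have "?a (s k i) = ?a z" "s k i \<noteq> z"
        using False by (auto simp: s_def Transposition.transpose_def)
      then have "\<not> inj ?a" by (metis injD)
      then show ?thesis using False by (simp add: skew_chain_not_inj)
    qed
    finally show ?thesis .
  qed
  then show ?thesis using that unfolding first by blast
qed

end

section \<open>Evaluating a left multiple of $tI - X$ at $X$\<close>

lemma lookup_single_times_add:
  "Poly_Mapping.lookup (Poly_Mapping.single m c * p) (m + d) = c * Poly_Mapping.lookup p d"
  for m :: nat and c :: "'r::ring_1"
  by (simp add: lookup_mult lookup_single when_mult)

lemma lookup_var_poly_times:
  "Poly_Mapping.lookup (var_poly * p) d = (if d = 0 then 0 else Poly_Mapping.lookup p (d - 1))"
proof (cases d)
  case 0
  then show ?thesis by (simp add: var_poly_def lookup_mult lookup_single when_mult)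
next
  case (Suc n)
  then show ?thesis using lookup_single_times_add[of 1 1 p n] by (simp add: var_poly_def)
qed

lemma lookup_const_poly_times:
  "Poly_Mapping.lookup (const_poly c * p) d = c * Poly_Mapping.lookup p d"
  using lookup_single_times_add[of 0 c p d] by (simp add: const_poly_def)

lemma lookup_times_const_poly:
  "Poly_Mapping.lookup (p * const_poly c) d = Poly_Mapping.lookup p d * c"
proof -
  have "Poly_Mapping.lookup p l * Sum_any (\<lambda>q. (c when 0 = q) when d = l + q) =
      (Poly_Mapping.lookup p l * c when l = d)" for l
  proof -
    have "Sum_any (\<lambda>q. (c when 0 = q) when d = l + q) = Sum_any (\<lambda>q :: nat. (c when d = l) when q = 0)"
      by (rule Sum_any.cong) (auto simp: when_def)
    then show ?thesis by (simp add: when_def)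
  qed
  then show ?thesis by (simp add: lookup_mult lookup_single const_poly_def)
qed

lemma matrix_times_nth: "(A ** B) $ a $ b = (\<Sum>c\<in>UNIV. A $ a $ c * B $ c $ b)" for A :: "'r::ring_1^'m^'n"
  by (simp add: matrix_matrix_mult_def)

lemma mat_times_nth: "(mat c ** A) $ a $ b = c * A $ a $ b" for A :: "'r::ring_1^'m^'n"
proof -
  have "(\<Sum>k\<in>UNIV. (if a = k then c else 0) * A $ k $ b) = (\<Sum>k\<in>UNIV. if a = k then c * A $ k $ b else 0)"
    by (rule sum.cong) auto
  then show ?thesis by (simp add: matrix_matrix_mult_def mat_def)
qed

lemma times_mat_nth: "(A ** mat c) $ a $ b = A $ a $ b * c" for A :: "'r::ring_1^'m^'n"
proof -
  have "(\<Sum>k\<in>UNIV. A $ a $ k * (if k = b then c else 0)) = (\<Sum>k\<in>UNIV. if k = b then A $ a $ k * c else 0)"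
    by (rule sum.cong) auto
  then show ?thesis by (simp add: matrix_matrix_mult_def mat_def)
qed

lemma matrix_power_commute:
  "matrix_power X d ** X = X ** matrix_power X d"
  by (induction d) (simp_all add: matrix_mul_assoc[symmetric])

lemma mat_matrix_power_commute:
  assumes "\<And>i j. c * X $ i $ j = X $ i $ j * c"
  shows "mat c ** matrix_power X d = matrix_power X d ** mat c"
proof (induction d)
  case (Suc d)
  have "mat c ** X = X ** mat c"
    using assms by (simp add: vec_eq_iff mat_times_nth times_mat_nth)
  then show ?case using Suc by (metis matrix_mul_assoc matrix_power.simps(2))
qed simp

lemma matrix_diff_ldistrib: "(A :: 'r::ring_1^'n^'m) ** (B - C) = A ** B - A ** C"
  by (simp add: vec_eq_iff matrix_matrix_mult_def right_diff_distrib sum_subtractf)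

text \<open>
  If $(tI - X) B(t) = q(t) I$, then substituting $X$ for $t$ with the powers of $X$ on the left gives $0$, because the
  sum telescopes. The coefficients of $q$ then stand on the right; centrality moves them to the left, where \<open>poly_at_matrix\<close>
  has them.
\<close>

lemma poly_at_matrix_eq_0_of_left_factor:
  fixes q :: "nat \<Rightarrow>\<^sub>0 'r::ring_1" and X :: "'r^'n::finite^'n" and B :: "'n \<Rightarrow> 'n \<Rightarrow> nat \<Rightarrow>\<^sub>0 'r"
  assumes factor: "\<And>i k. (\<Sum>j\<in>UNIV. ((if i = j then var_poly else 0) - const_poly (X $ i $ j)) * B j k)
      = (if i = k then q else 0)"
    and central: "\<And>i j. const_poly (X $ i $ j) * q = q * const_poly (X $ i $ j)"
  shows "poly_at_matrix q X = 0"
proof -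
  define C where "C d = (\<chi> j k. Poly_Mapping.lookup (B j k) d)" for d
  \<comment> \<open>The telescoping terms $X^d B_{d-1}$, with $B_{-1} = 0$.\<close>
  define T where "T d = (if d = 0 then 0 else matrix_power X d ** C (d - 1))" for d
  have coeff: "mat (Poly_Mapping.lookup q d) = (if d = 0 then 0 else C (d - 1)) - X ** C d" for d
  proof -
    have "(if i = k then Poly_Mapping.lookup q d else 0) =
      (if d = 0 then 0 else Poly_Mapping.lookup (B i k) (d - 1))
        - (\<Sum>j\<in>UNIV. X $ i $ j * Poly_Mapping.lookup (B j k) d)" for i k
    proof -
      have "(if i = k then Poly_Mapping.lookup q d else 0) = Poly_Mapping.lookup (if i = k then q else 0) d"
        by simp
      also have "(if i = k then q else 0) =
        (\<Sum>j\<in>UNIV. (if i = j then var_poly * B j k else 0) - const_poly (X $ i $ j) * B j k)"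
        unfolding factor[of i k, symmetric] by (auto simp: left_diff_distrib intro!: sum.cong)
      also have "Poly_Mapping.lookup \<dots> d = Poly_Mapping.lookup (var_poly * B i k) d
          - (\<Sum>j\<in>UNIV. Poly_Mapping.lookup (const_poly (X $ i $ j) * B j k) d)"
        by (simp add: sum_subtractf lookup_minus lookup_sum)
      finally show ?thesis by (simp add: lookup_var_poly_times lookup_const_poly_times)
    qed
    then show ?thesis by (simp add: vec_eq_iff mat_def matrix_matrix_mult_def C_def)
  qed
  have summand: "mat (Poly_Mapping.lookup q d) ** matrix_power X d = T d - T (Suc d)" for d
  proof -
    have "Poly_Mapping.lookup q d * X $ i $ j = X $ i $ j * Poly_Mapping.lookup q d" for i j
      using arg_cong[OF central[of i j], of "\<lambda>p. Poly_Mapping.lookup p d"]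
      by (simp add: lookup_const_poly_times lookup_times_const_poly)
    then have "mat (Poly_Mapping.lookup q d) ** matrix_power X d =
        matrix_power X d ** mat (Poly_Mapping.lookup q d)"
      by (rule mat_matrix_power_commute)
    also have "\<dots> = T d - T (Suc d)"
      by (simp add: coeff T_def matrix_diff_ldistrib matrix_mul_assoc matrix_power_commute)
    finally show ?thesis .
  qed
  have "finite (Poly_Mapping.keys q \<union> (\<Union>j k. Poly_Mapping.keys (B j k)))" by simp
  then obtain m where m: "\<And>d. d \<in> Poly_Mapping.keys q \<union> (\<Union>j k. Poly_Mapping.keys (B j k)) \<Longrightarrow> d < m"
    using finite_nat_set_iff_bounded by meson
  have C_0: "C m = 0"
    using m[of m] by (auto simp: vec_eq_iff C_def in_keys_iff)
  have "poly_at_matrix q X = (\<Sum>d<Suc m. mat (Poly_Mapping.lookup q d) ** matrix_power X d)"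
    unfolding poly_at_matrix_def
    by (rule sum.mono_neutral_left) (use m in \<open>auto simp: in_keys_iff less_Suc_eq\<close>)
  also have "\<dots> = T 0 - T (Suc m)"
    unfolding summand by (rule sum_lessThan_telescope')
  also have "\<dots> = 0" by (simp add: T_def C_0)
  finally show ?thesis .
qed

section \<open>The enveloping algebra of $gl(N)$\<close>

lemma const_poly_simps:
  "const_poly (a + b) = const_poly a + const_poly b"
  "const_poly (a - b) = const_poly a - const_poly b"
  "const_poly (a * b) = const_poly a * const_poly b"
  "const_poly 0 = 0" "const_poly 1 = 1"
  by (simp_all add: const_poly_def single_add single_diff mult_single)

lemma var_poly_central: "var_poly * const_poly c = const_poly c * var_poly"
  by (simp add: var_poly_def const_poly_def mult_single)

lemma ugl_scalar_simps:
  "ugl_scalar (a + b) = (ugl_scalar a + ugl_scalar b :: ('n, 'k::comm_ring_1) ugl)"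
  "ugl_scalar (a * b) = (ugl_scalar a * ugl_scalar b :: ('n, 'k::comm_ring_1) ugl)"
  "ugl_scalar 0 = (0 :: ('n, 'k::comm_ring_1) ugl)"
  "ugl_scalar 1 = (1 :: ('n, 'k::comm_ring_1) ugl)"
  by (transfer; simp add: single_add mult_single gl_ideal.zero)+

abbreviation scalar_poly :: "'k \<Rightarrow> nat \<Rightarrow>\<^sub>0 ('n, 'k::comm_ring_1) ugl" where
  "scalar_poly c \<equiv> const_poly (ugl_scalar c)"

lemma scalar_poly_sum: "scalar_poly (sum f S) = (\<Sum>x\<in>S. scalar_poly (f x))"
  by (induction S rule: infinite_finite_induct) (simp_all add: const_poly_simps ugl_scalar_simps)

lemma scalar_poly_of_nat: "scalar_poly (of_nat m) = of_nat m"
  by (induction m) (simp_all add: const_poly_simps ugl_scalar_simps)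

lemma scalar_poly_uminus: "scalar_poly (- c) = - scalar_poly c"
proof -
  have "scalar_poly (- c) + scalar_poly c = scalar_poly (- c + c)"
    by (simp only: const_poly_simps ugl_scalar_simps)
  then show ?thesis by (simp add: const_poly_simps ugl_scalar_simps eq_neg_iff_add_eq_0)
qed

lemma scalar_poly_of_sign: "scalar_poly (of_int (sign \<sigma>)) = of_int (sign \<sigma>)"
  by (cases \<sigma> rule: sign_cases) (simp_all add: scalar_poly_uminus const_poly_simps ugl_scalar_simps)

lemma scalar_poly_inverse_of_nat:
  fixes x :: "nat \<Rightarrow>\<^sub>0 ('n, 'k::field_char_0) ugl"
  assumes "m \<noteq> 0"
  shows "scalar_poly (1 / of_nat m) * (of_nat m * x) = x"
proof -
  have "scalar_poly (1 / of_nat m) * of_nat m * x = scalar_poly (1 / of_nat m * of_nat m) * x"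
    by (simp only: const_poly_simps ugl_scalar_simps scalar_poly_of_nat)
  also have "\<dots> = x" using assms by (simp add: const_poly_simps ugl_scalar_simps)
  finally show ?thesis by (simp only: mult.assoc)
qed

interpretation ugl: gl_pencil
  "\<lambda>i j. const_poly (ugl_gen i j :: ('n::{finite,linorder}, 'k::field_char_0) ugl)" var_poly
proof
  fix i j k l :: 'n
  have "const_poly (ugl_gen i j * ugl_gen k l - ugl_gen k l * ugl_gen i j :: ('n, 'k) ugl) =
     (if k = j then const_poly (ugl_gen i l) else 0) - (if i = l then const_poly (ugl_gen k j) else 0)"
    unfolding ugl_gen_commutator by (simp add: const_poly_simps)
  then show "const_poly (ugl_gen i j :: ('n, 'k) ugl) * const_poly (ugl_gen k l)
      - const_poly (ugl_gen k l) * const_poly (ugl_gen i j) =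
     (if k = j then const_poly (ugl_gen i l) else 0) - (if i = l then const_poly (ugl_gen k j) else 0)"
    by (simp add: const_poly_simps)
  show "var_poly * const_poly (ugl_gen i j :: ('n, 'k) ugl) = const_poly (ugl_gen i j) * var_poly"
    by (rule var_poly_central)
next
  fix m :: nat and x :: "nat \<Rightarrow>\<^sub>0 ('n, 'k) ugl"
  assume "of_nat m * x = 0"
  then show "m = 0 \<or> x = 0" using scalar_poly_inverse_of_nat[of m x] by fastforce
qed

lemma shifted_factor_nth:
  fixes k :: "'n::{finite,linorder}"
  shows "shifted_factor k (ugl_matrix :: ('n, 'k::field_char_0) ugl ^ _ ^ _) $ a $ b =
    (if \<forall>l. l \<noteq> k \<longrightarrow> a l = b l then ugl.pencil k (a k) (b k) else 0)"
proof -
  have "a = b \<longleftrightarrow> (\<forall>l. l \<noteq> k \<longrightarrow> a l = b l) \<and> a k = b k" by (auto simp: fun_eq_iff)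
  then show ?thesis
    by (auto simp: shifted_factor_def at_factor_def mat_def map_matrix_def ugl_matrix_def ugl.pencil_def)
qed

text \<open>
  Each factor changes the multi-index in its own position only, so the sum over intermediate multi-indices has at most
  one nonzero term.
\<close>

lemma shifted_factors_product_nth:
  fixes a b :: "'n::{finite,linorder} \<Rightarrow> 'n"
  assumes "distinct ks"
  shows "foldr (**) (map (\<lambda>k. shifted_factor k (ugl_matrix :: ('n, 'k::field_char_0) ugl ^ _ ^ _)) ks) (mat 1)
      $ a $ b = (if \<forall>l. l \<notin> set ks \<longrightarrow> a l = b l then ugl.chain ks a b else 0)"
  using assms
proof (induction ks arbitrary: a)
  case Nil
  then show ?case by (simp add: mat_def fun_eq_iff)
next
  case (Cons k ks)
  let ?M = "ugl_matrix :: ('n, 'k) ugl ^ _ ^ _"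
  let ?R = "foldr (**) (map (\<lambda>k. shifted_factor k ?M) ks) (mat 1)"
  have "foldr (**) (map (\<lambda>k. shifted_factor k ?M) (k # ks)) (mat 1) $ a $ b =
    (\<Sum>c\<in>UNIV. shifted_factor k ?M $ a $ c * ?R $ c $ b)"
    by (simp add: matrix_matrix_mult_def)
  also have "\<dots> = (\<Sum>c\<in>{a(k := b k)}. shifted_factor k ?M $ a $ c * ?R $ c $ b)"
  proof (rule sum.mono_neutral_right)
    show "\<forall>c\<in>UNIV - {a(k := b k)}. shifted_factor k ?M $ a $ c * ?R $ c $ b = 0"
    proof
      fix c assume c: "c \<in> UNIV - {a(k := b k)}"
      show "shifted_factor k ?M $ a $ c * ?R $ c $ b = 0"
      proof (rule ccontr)
        assume "shifted_factor k ?M $ a $ c * ?R $ c $ b \<noteq> 0"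
        then have "\<forall>l. l \<noteq> k \<longrightarrow> a l = c l" "\<forall>l. l \<notin> set ks \<longrightarrow> c l = b l"
          using Cons by (auto simp: shifted_factor_nth split: if_splits)
        then have "c = a(k := b k)" using Cons.prems by (auto simp: fun_eq_iff)
        then show False using c by simp
      qed
    qed
  qed auto
  also have "\<dots> = (if \<forall>l. l \<notin> set (k # ks) \<longrightarrow> a l = b l then ugl.chain (k # ks) a b else 0)"
  proof -
    have "ugl.chain ks (a(k := b k)) b = (ugl.chain ks a b :: nat \<Rightarrow>\<^sub>0 ('n, 'k) ugl)"
      by (rule ugl.chain_cong) (use Cons.prems in auto)
    moreover have "(\<forall>l. l \<notin> set ks \<longrightarrow> (a(k := b k)) l = b l) \<longleftrightarrow> (\<forall>l. l \<notin> set (k # ks) \<longrightarrow> a l = b l)"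
      using Cons.prems by auto
    moreover have "?R $ (a(k := b k)) $ b = (if \<forall>l. l \<notin> set ks \<longrightarrow> (a(k := b k)) l = b l
        then ugl.chain ks (a(k := b k)) b else 0)"
      using Cons by simp
    ultimately show ?thesis by (auto simp: shifted_factor_nth)
  qed
  finally show ?case .
qed

lemma char_poly_ugl_eq_row_det:
  "(char_poly_ugl :: nat \<Rightarrow>\<^sub>0 ('n::{finite,linorder}, 'k::field_char_0) ugl) = ugl.row_det"
proof -
  let ?ks = "sorted_list_of_set (UNIV :: 'n set)"
  let ?c = "1 / of_nat (fact CARD('n)) :: 'k"
  have sk: "(skew_symmetrizer :: 'k ^ ('n \<Rightarrow> 'n) ^ ('n \<Rightarrow> 'n)) $ a $ b =
    ?c * (\<Sum>\<sigma> | \<sigma> permutes UNIV. of_int (sign \<sigma>) * (if a = b \<circ> inv \<sigma> then 1 else 0))" for a b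
    by (simp add: skew_symmetrizer_def mat_times_nth permutation_operator_def)
  have skew: "ugl.skew_chain b b = (\<Sum>\<sigma> | \<sigma> permutes UNIV. of_int (sign \<sigma>) * ugl.chain ?ks b (b \<circ> inv \<sigma>)
      :: nat \<Rightarrow>\<^sub>0 ('n, 'k) ugl)" for b
    unfolding ugl.skew_chain_def
    by (subst sum_permutations_inverse, rule sum.cong)
      (simp_all add: sign_inverse permutes_imp_permutation[OF finite_class.finite_UNIV])
  have entry: "scalar_poly ((skew_symmetrizer :: 'k ^ ('n \<Rightarrow> 'n) ^ ('n \<Rightarrow> 'n)) $ a $ b) * x =
    scalar_poly ?c * (\<Sum>\<sigma> | \<sigma> permutes UNIV. if a = b \<circ> inv \<sigma> then of_int (sign \<sigma>) * x else 0)"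
    for a b and x :: "nat \<Rightarrow>\<^sub>0 ('n, 'k) ugl"
  proof -
    have "scalar_poly (of_int (sign \<sigma>) * (if a = b \<circ> inv \<sigma> then 1 else 0 :: 'k)) * x =
      (if a = b \<circ> inv \<sigma> then of_int (sign \<sigma>) * x else 0)" for \<sigma>
      by (simp add: scalar_poly_of_sign const_poly_simps ugl_scalar_simps)
    then have "scalar_poly (\<Sum>\<sigma> | \<sigma> permutes UNIV. of_int (sign \<sigma>) * (if a = b \<circ> inv \<sigma> then 1 else 0 :: 'k)) * x =
      (\<Sum>\<sigma> | \<sigma> permutes UNIV. if a = b \<circ> inv \<sigma> then of_int (sign \<sigma>) * x else 0)"
      by (simp only: scalar_poly_sum sum_distrib_right)
    then show ?thesis
      by (simp only: sk const_poly_simps ugl_scalar_simps mult.assoc)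
  qed
  have "(char_poly_ugl :: nat \<Rightarrow>\<^sub>0 ('n, 'k) ugl) =
    (\<Sum>a\<in>UNIV. \<Sum>b\<in>UNIV. scalar_poly ((skew_symmetrizer :: 'k ^ ('n \<Rightarrow> 'n) ^ ('n \<Rightarrow> 'n)) $ a $ b)
       * ugl.chain ?ks b a)"
    unfolding char_poly_ugl_def trace_def
    by (simp add: matrix_times_nth map_matrix_def shifted_factors_product_nth)
  also have "\<dots> = scalar_poly ?c * (\<Sum>a\<in>UNIV. \<Sum>b\<in>UNIV. \<Sum>\<sigma> | \<sigma> permutes UNIV.
      (if a = b \<circ> inv \<sigma> then of_int (sign \<sigma>) * ugl.chain ?ks b a else 0))"
    by (simp only: entry flip: sum_distrib_left)
  also have "\<dots> = scalar_poly ?c * (\<Sum>b\<in>UNIV. \<Sum>\<sigma> | \<sigma> permutes UNIV. \<Sum>a\<in>UNIV.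
      (if a = b \<circ> inv \<sigma> then of_int (sign \<sigma>) * ugl.chain ?ks b a else 0))"
    by (subst sum.swap, subst sum.swap[of _ UNIV "{\<sigma>. \<sigma> permutes UNIV}"]) rule
  also have "\<dots> = scalar_poly ?c * (\<Sum>b\<in>UNIV. \<Sum>\<sigma> | \<sigma> permutes UNIV.
      of_int (sign \<sigma>) * ugl.chain ?ks b (b \<circ> inv \<sigma>))"
    by simp
  also have "\<dots> = scalar_poly ?c * (\<Sum>b\<in>UNIV. ugl.skew_chain b b)"
    by (simp only: skew)
  also have "\<dots> = ugl.row_det"
    unfolding ugl.sum_skew_chain_diagonal by (rule scalar_poly_inverse_of_nat) simp
  finally show ?thesis .
qed

theorem Cayley_Hamilton_ugl:
  "poly_at_matrix (char_poly_ugl :: nat \<Rightarrow>\<^sub>0 ('n::{finite,linorder}, 'k::field_char_0) ugl) ugl_matrix = 0"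
proof -
  obtain B :: "'n \<Rightarrow> 'n \<Rightarrow> nat \<Rightarrow>\<^sub>0 ('n, 'k) ugl" where
    "\<And>i k. (\<Sum>j\<in>UNIV. ((if i = j then var_poly else 0) - const_poly (ugl_gen i j)) * B j k) =
      (if i = k then ugl.row_det else 0)"
    using ugl.row_expansion by blast
  then show ?thesis
    unfolding char_poly_ugl_eq_row_det
    by (intro poly_at_matrix_eq_0_of_left_factor[where B = B]) (simp_all add: ugl_matrix_def ugl.row_det_central)
qed

theorem corollary8:
  shows "poly_at_matrix (char_poly_ugl :: nat \<Rightarrow>\<^sub>0 ('n::{finite,linorder}, complex) ugl) ugl_matrix = 0
       \<and> poly_at_matrix (char_poly_ugl :: nat \<Rightarrow>\<^sub>0 ('n::{finite,linorder}, real) ugl) ugl_matrix = 0"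
  by (simp add: Cayley_Hamilton_ugl)

end
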